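(* Consider a query stream of rate $\lambda$ with sources $s_1,s_2$ and destination $d$, all of whose queries are computed at a single node $n$ of computation capacity $C_n$ in the network $\mathcal{G}$. If the system is stable under some policy in $\Pi_C$, then $$(\lambda,\lambda,\lambda)\in \Lambda_{\mathcal{G}}(\mathcal{C}_3)\qquad\text{and}\qquad \lambda\le C_n ,$$ where $\mathcal{C}_3=\{(s_1,n),(s_2,n),(n,d)\}$.
   Context: Network: $\mathcal{G}=(\mathcal{V},\mathcal{E})$ is a finite graph with undirected edges; the edge between $m$ and $k$ has a fixed capacity $R_{mk}=R_{km}$ (packets per slot), shared by the two directions. $s_1,s_2\in\mathcal{V}$ are the sources, $d\in\mathcal{V}$ the destination, $n\in\mathcal{V}$ the computation node, which can process at most $C_n$ pairs per slot. Queries: time is slotted; $A(t)$ queries arrive in slot $t$, where $A(t)$ is i.i.d. over time with values in the nonnegative integers and $\mathbb{E}[A(t)]=\lambda$. Each query generates one raw packet at $s_1$ and one raw packet at $s_2$, both carrying the same tag (distinct queries have distinct tags). The two raw packets of a query must both be brought to $n$ and combined there into one processed packet, which must be delivered to $d$. Queues (capital letters are lengths at slot $t$): $Q_k^{(i,n)}(t)$, $i=1,2$, counts raw packets from $s_i$ waiting at node $k$ on their way to $n$ (with $Q_n^{(i,n)}(t)=0$); $X_n^{(i)}(t)$, $i=1,2$, counts raw packets from $s_i$ that have reached $n$ and wait to be combined, and $\mathcal{X}_n^{(i)}(t)$ denotes their set of tags; $Q_k^{(0,n)}(t)$ counts processed packets waiting at node $k$ on their way to $d$ (with $Q_d^{(0,n)}(t)=0$).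 Newly generated raw packets join $Q_{s_i}^{(i,n)}$ (or $X_n^{(i)}$ if $s_i=n$), processed packets created at $n$ join $Q_n^{(0,n)}$ (or leave if $n=d$). Policies $\Pi_C$: in every slot the policy chooses, based on the network state, the numbers $U_{mk}^{(i,n)}(t)\ge 0$ of packets of class $i\in\{0,1,2\}$ transmitted from $m$ to $k$ and a set $\mathcal{Z}_n(t)$ of $Z_n(t)$ tags whose raw packets are combined at $n$, subject to: (i) $\sum_{i\in\{0,1,2\}}\big(U_{mk}^{(i,n)}(t)+U_{km}^{(i,n)}(t)\big)\le R_{mk}$ for each edge; (ii) $0\le Z_n(t)\le\min[C_n,X_n^{(1)}(t),X_n^{(2)}(t)]$; (iii) $\mathcal{Z}_n(t)\subseteq \mathcal{X}_n^{(1)}(t)\cap\mathcal{X}_n^{(2)}(t)$. If more service is allocated on links than there are packets in the queue, only the existing packets are moved. Stability: the system is stable if all queues are strongly stable, i.e. $\limsup_{T\to\infty}\frac1T\sum_{t=1}^T\mathbb{E}[Q_k^{(i,n)}(t)]<\infty$ for all $k\in\mathcal{V}$, $i\in\{0,1,2\}$, and $\limsup_{T\to\infty}\frac1T\sum_{t=1}^T\mathbb{E}[X_n^{(i)}(t)]<\infty$ for $i\in\{1,2\}$. Flow region: for a finite set $\mathcal{C}$ of commodities (source–destination pairs), $\Lambda_{\mathcal{G}}(\mathcal{C})$ is the set of rate vectors $(\lambda^{(c)})_{c\in\mathcal{C}}$ for which there exist flows $f_{mk}^{(c)}\ge 0$ (for each edge and each of its two directions) such that for every $c$ and node $m$, $\sum_k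 f_{mk}^{(c)}-\sum_k f_{km}^{(c)}$ (sums over neighbours $k$ of $m$) equals $\lambda^{(c)}$ if $m$ is the source of $c$, $-\lambda^{(c)}$ if $m$ is the destination of $c$, and $0$ otherwise; $f_{mk}^{(c)}=0$ whenever $m$ is the destination of $c$; and $\sum_{c}\big(f_{mk}^{(c)}+f_{km}^{(c)}\big)\le R_{mk}$ for each edge. A commodity whose source equals its destination requires no flow. *)

theory Defs
  imports "HOL-Probability.Probability"
begin

(* Edges are two-element sets of nodes, so capacities are symmetric by construction. *)
record 'v network =
  nodes :: "'v set"
  edges :: "'v set set"
  edge_cap :: "'v set \<Rightarrow> real"
  source1 :: 'v
  source2 :: 'v
  comp_node :: 'v
  dest :: 'v
  comp_cap :: real

definition computation_network :: "'v network \<Rightarrow> bool" where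
  "computation_network G \<longleftrightarrow>
     finite (nodes G) \<and>
     edges G \<subseteq> {e. e \<subseteq> nodes G \<and> card e = 2} \<and>
     (\<forall>e\<in>edges G. 0 \<le> edge_cap G e) \<and>
     {source1 G, source2 G, comp_node G, dest G} \<subseteq> nodes G \<and>
     0 \<le> comp_cap G"

definition nbrs :: "'v network \<Rightarrow> 'v \<Rightarrow> 'v set" where
  "nbrs G m = {k. {m, k} \<in> edges G}"

(* Commodities and rates are lists, so that repeated source-destination pairs (for instance when
   the two sources coincide) still count as separate commodities.  A commodity whose source is
   its destination carries no flow, whatever its rate. *)
definition flow_region :: "'v network \<Rightarrow> ('v \<times> 'v) list \<Rightarrow> real list set" where
  "flow_region G cs = {r. length r = length cs \<and>
     (\<exists>f :: nat \<Rightarrow> 'v \<Rightarrow> 'v \<Rightarrow> real.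
        (\<forall>c < length cs. \<forall>m k. {m, k} \<in> edges G \<longrightarrow> 0 \<le> f c m k) \<and>
        (\<forall>c < length cs. let a = fst (cs ! c); b = snd (cs ! c) in
           if a = b then \<forall>m k. {m, k} \<in> edges G \<longrightarrow> f c m k = 0
           else (\<forall>m\<in>nodes G.
                   (\<Sum>k\<in>nbrs G m. f c m k) - (\<Sum>k\<in>nbrs G m. f c k m) =
                     (if m = a then r ! c else if m = b then - (r ! c) else 0)) \<and>
                (\<forall>k\<in>nbrs G b. f c b k = 0)) \<and>
        (\<forall>m k. {m, k} \<in> edges G \<longrightarrow>
           (\<Sum>c<length cs. f c m k + f c k m) \<le> edge_cap G {m, k}))}"

(* Arrival t j tags the j-th query arriving in slot t; Initial j tags a query whose packets are
   already in the network at slot 0. *)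
datatype tag = Initial nat | Arrival nat nat

(* Class 0: processed packets; classes 1 and 2: raw packets of the two sources.  queue s i k is
   the set of tags of the class-i packets waiting at node k to be forwarded, waiting s i the set
   of tags of the raw packets of source i waiting at the computation node to be combined. *)
record 'v state =
  queue :: "nat \<Rightarrow> 'v \<Rightarrow> tag set"
  waiting :: "nat \<Rightarrow> tag set"

(* service is the number of packets allocated to a link direction and class, moved the set of
   packets actually transferred. *)
record 'v decision =
  service :: "nat \<Rightarrow> 'v \<Rightarrow> 'v \<Rightarrow> nat"
  moved :: "nat \<Rightarrow> 'v \<Rightarrow> 'v \<Rightarrow> tag set"
  combined :: "tag set"

definition origin :: "'v network \<Rightarrow> nat \<Rightarrow> 'v" where
  "origin G i = (if i = 0 then comp_node G else if i = 1 then source1 G else source2 G)"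

definition target :: "'v network \<Rightarrow> nat \<Rightarrow> 'v" where
  "target G i = (if i = 0 then dest G else comp_node G)"

(* The last condition on moved: all allocated service is used, except that a queue holding fewer
   packets than its outgoing links offer is just emptied. *)
definition feasible :: "'v network \<Rightarrow> 'v state \<Rightarrow> 'v decision \<Rightarrow> bool" where
  "feasible G s D \<longleftrightarrow>
     (\<forall>m k. {m, k} \<in> edges G \<longrightarrow>
        real (\<Sum>i\<in>{0,1,2}. service D i m k + service D i k m) \<le> edge_cap G {m, k}) \<and>
     (\<forall>i\<in>{0,1,2}. \<forall>m\<in>nodes G.
        (\<forall>k\<in>nbrs G m. moved D i m k \<subseteq> queue s i m \<and> card (moved D i m k) \<le> service D i m k) \<and>
        disjoint_family_on (moved D i m) (nbrs G m) \<and>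
        (\<Sum>k\<in>nbrs G m. card (moved D i m k)) =
          min (card (queue s i m)) (\<Sum>k\<in>nbrs G m. service D i m k)) \<and>
     real (card (combined D)) \<le>
       min (comp_cap G) (min (real (card (waiting s 1))) (real (card (waiting s 2)))) \<and>
     combined D \<subseteq> waiting s 1 \<inter> waiting s 2"

(* B is the set of tags of the queries arriving in the current slot. *)
definition next_state ::
  "'v network \<Rightarrow> 'v state \<Rightarrow> 'v decision \<Rightarrow> tag set \<Rightarrow> 'v state" where
  "next_state G s D B =
     \<lparr> queue = (\<lambda>i k. if k = target G i then {}
         else (queue s i k - (\<Union>l\<in>nbrs G k. moved D i k l)) \<union>
              (\<Union>m\<in>nbrs G k. moved D i m k) \<union>
              (if k = origin G i then (if i = 0 then combined D else B) else {})),
       waiting = (\<lambda>i. (waiting s i - combined D) \<union>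
              (\<Union>m\<in>nbrs G (comp_node G). moved D i m (comp_node G)) \<union>
              (if origin G i = comp_node G then B else {})) \<rparr>"

definition initial_state :: "'v network \<Rightarrow> 'v state \<Rightarrow> bool" where
  "initial_state G s \<longleftrightarrow>
     (\<forall>i\<in>{0,1,2}. (\<forall>k\<in>nodes G. finite (queue s i k) \<and> queue s i k \<subseteq> range Initial) \<and>
        disjoint_family_on (queue s i) (nodes G) \<and> queue s i (target G i) = {}) \<and>
     (\<forall>i\<in>{1,2}. finite (waiting s i) \<and> waiting s i \<subseteq> range Initial \<and>
        (\<forall>k\<in>nodes G. queue s i k \<inter> waiting s i = {}) \<and>
        (\<forall>k\<in>nodes G. queue s 0 k \<inter> ((\<Union>l\<in>nodes G. queue s i l) \<union> waiting s i) = {}))"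

(* A policy picks the decision of slot t from a random seed and the states of slots 0, ..., t. *)
type_synonym ('w, 'v) policy = "'w \<Rightarrow> 'v state list \<Rightarrow> 'v decision"

definition Pi_C :: "'v network \<Rightarrow> ('w, 'v) policy set" where
  "Pi_C G = {p. \<forall>w h. h \<noteq> [] \<longrightarrow> feasible G (last h) (p w h)}"

(* The states of slots 0, ..., t when a u queries arrive in slot u. *)
primrec history ::
  "'v network \<Rightarrow> ('w, 'v) policy \<Rightarrow> 'v state \<Rightarrow> 'w \<Rightarrow> (nat \<Rightarrow> nat) \<Rightarrow> nat \<Rightarrow> 'v state list" where
  "history G p s0 w a 0 = [s0]"
| "history G p s0 w a (Suc t) = history G p s0 w a t @
     [next_state G (last (history G p s0 w a t)) (p w (history G p s0 w a t))
        (Arrival t ` {..<a t})]"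

definition state_at ::
  "'v network \<Rightarrow> ('w, 'v) policy \<Rightarrow> 'v state \<Rightarrow> 'w \<Rightarrow> (nat \<Rightarrow> nat) \<Rightarrow> nat \<Rightarrow> 'v state" where
  "state_at G p s0 w a t = last (history G p s0 w a t)"

definition decision_at ::
  "'v network \<Rightarrow> ('w, 'v) policy \<Rightarrow> 'v state \<Rightarrow> 'w \<Rightarrow> (nat \<Rightarrow> nat) \<Rightarrow> nat \<Rightarrow> 'v decision" where
  "decision_at G p s0 w a t = p w (history G p s0 w a t)"

definition query_arrivals :: "'a measure \<Rightarrow> (nat \<Rightarrow> 'a \<Rightarrow> nat) \<Rightarrow> real \<Rightarrow> bool" where
  "query_arrivals M A rate \<longleftrightarrow>
     prob_space M \<and>
     prob_space.indep_vars M (\<lambda>_. count_space UNIV) A UNIV \<and>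
     (\<forall>t. distr M (count_space UNIV) (A t) = distr M (count_space UNIV) (A 0)) \<and>
     (\<forall>t. has_bochner_integral M (\<lambda>x. real (A t x)) rate)"

(* The seed is the private randomness of the policy.  Its independence of the arrivals keeps the
   policy non-anticipating: arrivals become known only through the network state.  (The library's
   indep_var would require both variables to have the same type.) *)
definition policy_seed ::
  "'a measure \<Rightarrow> (nat \<Rightarrow> 'a \<Rightarrow> nat) \<Rightarrow> 'w measure \<Rightarrow> ('a \<Rightarrow> 'w) \<Rightarrow> bool" where
  "policy_seed M A N \<xi> \<longleftrightarrow>
     \<xi> \<in> measurable M N \<and>
     prob_space.indep_set M
       (sets (vimage_algebra (space M) \<xi> N))
       (sets (vimage_algebra (space M) (\<lambda>x t. A t x) (PiM UNIV (\<lambda>_. count_space UNIV))))"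

(* The decisions taken along a run are random variables.  A random set is measurable when all its
   membership events are. *)
definition measurable_decisions ::
  "'v network \<Rightarrow> 'a measure \<Rightarrow> (nat \<Rightarrow> 'a \<Rightarrow> nat) \<Rightarrow> ('a \<Rightarrow> 'w) \<Rightarrow> ('w, 'v) policy \<Rightarrow> 'v state \<Rightarrow> bool"
  where
  "measurable_decisions G M A \<xi> p s0 \<longleftrightarrow>
     (let D = (\<lambda>t x. decision_at G p s0 (\<xi> x) (\<lambda>u. A u x) t) in
       (\<forall>t. \<forall>i\<in>{0,1,2}. \<forall>m k. {m, k} \<in> edges G \<longrightarrow>
          (\<lambda>x. service (D t x) i m k) \<in> measurable M (count_space UNIV) \<and>
          (\<forall>q. {x \<in> space M. q \<in> moved (D t x) i m k} \<in> sets M)) \<and>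
       (\<forall>t q. {x \<in> space M. q \<in> combined (D t x)} \<in> sets M))"

(* Expectations are taken in ennreal, so an infinite expected queue length is really infinite. *)
definition strongly_stable :: "'a measure \<Rightarrow> (nat \<Rightarrow> 'a \<Rightarrow> nat) \<Rightarrow> bool" where
  "strongly_stable M L \<longleftrightarrow>
     limsup (\<lambda>T. (\<Sum>t=1..T. \<integral>\<^sup>+ x. of_nat (L t x) \<partial>M) / of_nat T :: ennreal) < \<infinity>"

definition stable_system ::
  "'v network \<Rightarrow> 'a measure \<Rightarrow> (nat \<Rightarrow> 'a \<Rightarrow> nat) \<Rightarrow> ('a \<Rightarrow> 'w) \<Rightarrow> ('w, 'v) policy \<Rightarrow> 'v state \<Rightarrow> bool"
  where
  "stable_system G M A \<xi> p s0 \<longleftrightarrow>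
     (let S = (\<lambda>t x. state_at G p s0 (\<xi> x) (\<lambda>u. A u x) t) in
       (\<forall>k\<in>nodes G. \<forall>i\<in>{0,1,2}. strongly_stable M (\<lambda>t x. card (queue (S t x) i k))) \<and>
       (\<forall>i\<in>{1,2}. strongly_stable M (\<lambda>t x. card (waiting (S t x) i))))"

end

theory Submission
  imports Defs "HOL-Real_Asymp.Real_Asymp"
begin

text \<open>
  Packets carry tags and no tag is ever at two places for the same class, so along every run the
  queue lengths satisfy an exact balance equation: the increment of a queue is what is moved in, plus
  what arrives or is combined, minus what is moved out. Expectations of the moved and combined
  numbers are bounded by the capacities, so the balance survives integration. Strong stability
  provides infinitely many slots at which all expected queue lengths stay below one constant; along
  such slots the time-averaged drift vanishes, and by compactness the averaged expected flows
  converge on a further subsequence. The limits conserve flow at every node. The rate of combinations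
  at the computation node is at most its capacity, and the balance of the raw packets
  of the first source forces it to equal the arrival rate, which is then also the rate at which
  processed packets are injected.
\<close>

section \<open>Pathwise packet balance\<close>

text \<open>The queries of slot \<open>u\<close> first appear in the state of slot
  \<open>u + 1\<close>, hence the strict bound. All indices of a past slot are included, so the set
  does not depend on how many queries arrived, and it excludes every tag of the current
  slot.\<close>

definition known_tags :: "nat \<Rightarrow> tag set" where
  "known_tags t = range Initial \<union> (\<Union>u<t. range (Arrival u))"

text \<open>The invariant of a run: \<open>initial_state\<close> with the initial tags replaced by
  \<open>known_tags t\<close>. Keeping processed tags apart from raw ones ensures that a newly
  combined tag is new to class 0.\<close>

definition consistent :: "'v network \<Rightarrow> nat \<Rightarrow> 'v state \<Rightarrow> bool" where
  "consistent G t s \<longleftrightarrow>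
     (\<forall>i\<in>{0,1,2}. (\<forall>k\<in>nodes G. finite (queue s i k) \<and> queue s i k \<subseteq> known_tags t) \<and>
        disjoint_family_on (queue s i) (nodes G) \<and> queue s i (target G i) = {}) \<and>
     (\<forall>i\<in>{1,2}. finite (waiting s i) \<and> waiting s i \<subseteq> known_tags t \<and>
        (\<forall>k\<in>nodes G. queue s i k \<inter> waiting s i = {}) \<and>
        (\<forall>k\<in>nodes G. queue s 0 k \<inter> ((\<Union>l\<in>nodes G. queue s i l) \<union> waiting s i) = {}))"

lemma initial_state_consistent: "initial_state G s \<Longrightarrow> consistent G 0 s"
  unfolding initial_state_def consistent_def known_tags_def by simp

lemma nbrs_sym: "k \<in> nbrs G m \<longleftrightarrow> m \<in> nbrs G k"
  by (simp add: nbrs_def insert_commute)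

locale comp_network =
  fixes G :: "'v network"
  assumes network: "computation_network G"
begin

lemma finite_nodes: "finite (nodes G)"
  using network by (simp add: computation_network_def)

lemma edge_nodes:
  assumes "{m, k} \<in> edges G"
  shows "m \<in> nodes G" "k \<in> nodes G" "m \<noteq> k"
proof -
  have "{m, k} \<subseteq> nodes G" "card {m, k} = 2"
    using assms network by (auto simp: computation_network_def)
  then show "m \<in> nodes G" "k \<in> nodes G" "m \<noteq> k"
    by (auto simp: card_insert_if split: if_splits)
qed

lemma nbrs_nodes: "k \<in> nbrs G m \<Longrightarrow> k \<in> nodes G" "k \<in> nbrs G m \<Longrightarrow> m \<in> nodes G"
  "k \<in> nbrs G m \<Longrightarrow> m \<noteq> k"
  using edge_nodes[of m k] by (auto simp: nbrs_def)

lemma finite_nbrs: "finite (nbrs G m)"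
  using finite_subset[OF _ finite_nodes, of "nbrs G m"] nbrs_nodes(1) by blast

lemma special_nodes: "comp_node G \<in> nodes G" "origin G i \<in> nodes G" "target G i \<in> nodes G"
  using network by (auto simp: computation_network_def origin_def target_def)

end

section \<open>A single slot: consequences of consistency and feasibility\<close>

locale slot = comp_network G for G :: "'v network" +
  fixes s :: "'v state" and D :: "'v decision" and t a :: nat
  assumes consistent: "consistent G t s" and feasible: "feasible G s D"
begin

abbreviation B :: "tag set" where "B \<equiv> Arrival t ` {..<a}"

abbreviation s' :: "'v state" where "s' \<equiv> next_state G s D B"

lemma finite_queue: "i \<in> {0,1,2} \<Longrightarrow> k \<in> nodes G \<Longrightarrow> finite (queue s i k)"
  and queue_known: "i \<in> {0,1,2} \<Longrightarrow> k \<in> nodes G \<Longrightarrow> queue s i k \<subseteq> known_tags t"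
  and queue_target: "i \<in> {0,1,2} \<Longrightarrow> queue s i (target G i) = {}"
  and finite_waiting: "i \<in> {1,2} \<Longrightarrow> finite (waiting s i)"
  and waiting_known: "i \<in> {1,2} \<Longrightarrow> waiting s i \<subseteq> known_tags t"
  using consistent unfolding consistent_def by blast+

lemma queue_unique:
  "i \<in> {0,1,2} \<Longrightarrow> k \<in> nodes G \<Longrightarrow> l \<in> nodes G \<Longrightarrow> q \<in> queue s i k \<Longrightarrow> q \<in> queue s i l \<Longrightarrow> k = l"
  using consistent unfolding consistent_def disjoint_family_on_def by blast

lemma queue_not_waiting:
  "i \<in> {1,2} \<Longrightarrow> k \<in> nodes G \<Longrightarrow> q \<in> queue s i k \<Longrightarrow> q \<notin> waiting s i"
  using consistent unfolding consistent_def by blast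

lemma processed_not_queued:
  "i \<in> {1,2} \<Longrightarrow> k \<in> nodes G \<Longrightarrow> l \<in> nodes G \<Longrightarrow> q \<in> queue s 0 k \<Longrightarrow> q \<notin> queue s i l"
  using consistent unfolding consistent_def by blast

lemma processed_not_waiting:
  "i \<in> {1,2} \<Longrightarrow> k \<in> nodes G \<Longrightarrow> q \<in> queue s 0 k \<Longrightarrow> q \<notin> waiting s i"
  using consistent unfolding consistent_def by blast

lemma moved_queue: "i \<in> {0,1,2} \<Longrightarrow> k \<in> nbrs G m \<Longrightarrow> moved D i m k \<subseteq> queue s i m"
  using feasible nbrs_nodes unfolding feasible_def by blast

lemma card_moved_le: "i \<in> {0,1,2} \<Longrightarrow> k \<in> nbrs G m \<Longrightarrow> card (moved D i m k) \<le> service D i m k"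
  using feasible nbrs_nodes unfolding feasible_def by blast

lemma moved_unique:
  "i \<in> {0,1,2} \<Longrightarrow> k \<in> nbrs G m \<Longrightarrow> l \<in> nbrs G m \<Longrightarrow> q \<in> moved D i m k \<Longrightarrow> q \<in> moved D i m l \<Longrightarrow> k = l"
  using feasible nbrs_nodes unfolding feasible_def disjoint_family_on_def by blast

text \<open>Oriented along the links into \<open>k\<close>, the form in which
  \<open>next_state\<close> collects received packets.\<close>

lemma movedD:
  assumes "i \<in> {0,1,2}" "m \<in> nbrs G k" "q \<in> moved D i m k"
  shows "m \<in> nodes G" "k \<in> nodes G" "k \<in> nbrs G m" "q \<in> queue s i m" "m \<noteq> k"
proof -
  show *: "k \<in> nbrs G m" using assms(2) by (simp add: nbrs_sym)
  show "m \<in> nodes G" "k \<in> nodes G" "m \<noteq> k" using nbrs_nodes[OF *] by auto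
  show "q \<in> queue s i m" using moved_queue[OF assms(1) *] assms(3) by blast
qed

text \<open>A moved packet lies in the queue of its sender, so disjoint queues determine the sender;
  disjoint transfers out of that sender then determine the receiver.\<close>

lemma moved_unique_link:
  assumes i: "i \<in> {0,1,2}" and "m \<in> nbrs G k" "n \<in> nbrs G l" "q \<in> moved D i m k" "q \<in> moved D i n l"
  shows "m = n" "k = l"
proof -
  note m = movedD[OF i assms(2,4)] and n = movedD[OF i assms(3,5)]
  show "m = n" using queue_unique[OF i m(1) n(1) m(4) n(4)] .
  with moved_unique[OF i m(3), of l q] n(3) assms(4,5) show "k = l" by simp
qed

lemma finite_moved: "i \<in> {0,1,2} \<Longrightarrow> k \<in> nbrs G m \<Longrightarrow> finite (moved D i m k)"
  using finite_subset[OF moved_queue finite_queue] nbrs_nodes(2) by metis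

lemma finite_moved_in: "i \<in> {0,1,2} \<Longrightarrow> finite (\<Union>m\<in>nbrs G k. moved D i m k)"
  by (intro finite_UN_I finite_nbrs finite_moved) (auto simp: nbrs_sym[of k])

lemma moved_target: "i \<in> {0,1,2} \<Longrightarrow> k \<in> nbrs G (target G i) \<Longrightarrow> moved D i (target G i) k = {}"
  using moved_queue queue_target by blast

lemma combined_waiting: "i \<in> {1,2} \<Longrightarrow> combined D \<subseteq> waiting s i"
  using feasible unfolding feasible_def by blast

lemma card_combined_le: "real (card (combined D)) \<le> comp_cap G"
  using feasible unfolding feasible_def by auto

text \<open>Transfers never exceed the allocated service, so they inherit its capacity constraint.
  This is what bounds the flows later on.\<close>

lemma link_capacity:
  assumes "{m, k} \<in> edges G"
  shows "(\<Sum>i\<in>{0,1,2}. real (card (moved D i m k)) + real (card (moved D i k m))) \<le> edge_cap G {m, k}"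
proof -
  have *: "k \<in> nbrs G m" "m \<in> nbrs G k" using assms by (auto simp: nbrs_def insert_commute)
  have "(\<Sum>i\<in>{0,1,2}. card (moved D i m k) + card (moved D i k m))
      \<le> (\<Sum>i\<in>{0,1,2}. service D i m k + service D i k m)"
    by (intro sum_mono add_mono card_moved_le *)
  then have "real (\<Sum>i\<in>{0,1,2}. card (moved D i m k) + card (moved D i k m))
      \<le> real (\<Sum>i\<in>{0,1,2}. service D i m k + service D i k m)"
    by (simp only: of_nat_le_iff)
  also have "\<dots> \<le> edge_cap G {m, k}"
    using feasible assms unfolding feasible_def by blast
  finally show ?thesis by simp
qed

lemma B_fresh: "q \<in> B \<Longrightarrow> q \<notin> known_tags t"
  by (auto simp: known_tags_def)

lemma card_B: "card B = a"
  by (subst card_image) (auto simp: inj_on_def)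

text \<open>The external input of a class at its origin, so that raw and processed packets can be
  treated by the same arguments.\<close>

definition added :: "nat \<Rightarrow> tag set" where
  "added i = (if i = 0 then combined D else B)"

lemma finite_combined: "finite (combined D)"
  using combined_waiting[of 1] finite_waiting[of 1] finite_subset by auto

lemma finite_added: "finite (added i)"
  using finite_combined by (auto simp: added_def)

text \<open>For class 0 the combined tags were waiting, and waiting tags are in no processed queue;
  for raw classes the arrivals carry the current slot in their tag, which no known tag does.\<close>

lemma added_fresh:
  assumes "i \<in> {0,1,2}" "k \<in> nodes G" "q \<in> added i"
  shows "q \<notin> queue s i k"
proof (cases "i = 0")
  case True
  then have "q \<in> waiting s 1" using assms combined_waiting[of 1] by (auto simp: added_def)
  then show ?thesis using processed_not_waiting[of 1 k q] True assms by auto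
next
  case False
  then show ?thesis using assms B_fresh queue_known[of i k] by (auto simp: added_def)
qed

section \<open>Preservation of consistency from one slot to the next\<close>

lemma queue_next: "queue s' i k = (if k = target G i then {}
   else (queue s i k - (\<Union>l\<in>nbrs G k. moved D i k l)) \<union> (\<Union>m\<in>nbrs G k. moved D i m k) \<union>
     (if k = origin G i then added i else {}))"
  by (simp add: next_state_def added_def)

lemma waiting_next: "waiting s' i = (waiting s i - combined D) \<union>
    (\<Union>m\<in>nbrs G (comp_node G). moved D i m (comp_node G)) \<union>
    (if origin G i = comp_node G then B else {})"
  by (simp add: next_state_def)

lemma queue_next_cases:
  assumes "q \<in> queue s' i k"
  obtains (stay) "q \<in> queue s i k" "\<And>l. l \<in> nbrs G k \<Longrightarrow> q \<notin> moved D i k l"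
  | (move) m where "m \<in> nbrs G k" "q \<in> moved D i m k"
  | (new) "k = origin G i" "q \<in> added i"
  using assms by (auto simp: queue_next split: if_splits)

lemma waiting_next_cases:
  assumes "q \<in> waiting s' i"
  obtains (stay) "q \<in> waiting s i" "q \<notin> combined D"
  | (move) m where "m \<in> nbrs G (comp_node G)" "q \<in> moved D i m (comp_node G)"
  | (new) "origin G i = comp_node G" "q \<in> B"
  using assms by (auto simp: waiting_next split: if_splits)

lemma queue_next_tags:
  assumes "i \<in> {0,1,2}" "k \<in> nodes G" "q \<in> queue s' i k"
  shows "(\<exists>l\<in>nodes G. q \<in> queue s i l) \<or> q \<in> added i"
  using assms(3)
  by (cases rule: queue_next_cases) (use assms(2) movedD[OF assms(1)] in blast)+

text \<open>Forgets where the packet came from but records that an old waiting packet was not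
  combined; this separates it from the packets just processed.\<close>

lemma waiting_next_tags:
  assumes "i \<in> {1,2}" "q \<in> waiting s' i"
  shows "(\<exists>l\<in>nodes G. q \<in> queue s i l) \<or> (q \<in> waiting s i \<and> q \<notin> combined D) \<or> q \<in> B"
proof -
  have "i \<in> {0,1,2}" using assms by auto
  from assms(2) show ?thesis
    by (cases rule: waiting_next_cases) (use movedD[OF \<open>i \<in> {0,1,2}\<close>] in blast)+
qed

lemma known_tags_Suc: "known_tags t \<subseteq> known_tags (Suc t)" "B \<subseteq> known_tags (Suc t)"
  unfolding known_tags_def by force+

lemma added_known: "added i \<subseteq> known_tags (Suc t)"
  using known_tags_Suc combined_waiting[of 1] waiting_known[of 1] by (auto simp: added_def)

lemma queue_next_disjoint:
  assumes i: "i \<in> {0,1,2}" and kl: "k \<in> nodes G" "l \<in> nodes G"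
    and q: "q \<in> queue s' i k" "q \<in> queue s' i l"
  shows "k = l"
proof -
  \<comment> \<open>A packet that stays at \<open>k\<close> cannot also be received somewhere: by
    uniqueness its sender would be \<open>k\<close>, and it would then be on an outgoing link of
    \<open>k\<close>.\<close>
  have stay_move: False
    if "q \<in> queue s i k" "\<And>l. l \<in> nbrs G k \<Longrightarrow> q \<notin> moved D i k l"
       "m \<in> nbrs G l" "q \<in> moved D i m l" "k \<in> nodes G" for k l m
  proof -
    note m = movedD[OF i that(3,4)]
    have "m = k" using queue_unique[OF i m(1) that(5) m(4) that(1)] .
    then show False using that(2)[of l] that(4) m(3) by simp
  qed
  have not_added: "q \<notin> added i" if "m \<in> nbrs G l" "q \<in> moved D i m l" for m l
    using added_fresh[OF i] movedD[OF i that] by blast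
  from q(1) show ?thesis
  proof (cases rule: queue_next_cases)
    case k: stay
    from q(2) show ?thesis
    proof (cases rule: queue_next_cases)
      case stay then show ?thesis using k queue_unique[OF i kl] by blast
    next
      case (move m) then show ?thesis using k stay_move kl by blast
    next
      case new then show ?thesis using k added_fresh[OF i kl(1)] by blast
    qed
  next
    case k: (move m)
    from q(2) show ?thesis
    proof (cases rule: queue_next_cases)
      case stay then show ?thesis using k stay_move kl by blast
    next
      case (move n) then show ?thesis using k moved_unique_link(2)[OF i] by blast
    next
      case new then show ?thesis using k not_added by blast
    qed
  next
    case k: new
    from q(2) show ?thesis
    proof (cases rule: queue_next_cases)
      case stay then show ?thesis using k added_fresh[OF i kl(2)] by blast
    next
      case (move n) then show ?thesis using k not_added by blast
    next
      case new then show ?thesis using k by simp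
    qed
  qed
qed

lemma queue_waiting_next_disjoint:
  assumes i: "i \<in> {1,2}" and k: "k \<in> nodes G"
    and q: "q \<in> queue s' i k" "q \<in> waiting s' i"
  shows False
proof -
  have i': "i \<in> {0,1,2}" and added: "added i = B" and tgt: "target G i = comp_node G"
    using i by (auto simp: added_def target_def)
  \<comment> \<open>Raw queues are empty at the computation node, so the two places differ. This
    excludes both a single transfer ending in the queue and in the waiting set, and an arrival
    joining both.\<close>
  have kn: "k \<noteq> comp_node G" using q(1) tgt by (auto simp: queue_next)
  have fresh: "q \<notin> B" if "q \<in> queue s i l" "l \<in> nodes G" for l
    using that B_fresh queue_known[OF i'] by blast
  have wfresh: "q \<notin> B" if "q \<in> waiting s i"
    using that B_fresh waiting_known[OF i] by blast
  from q(2) show False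
  proof (cases rule: waiting_next_cases)
    case w: stay
    from q(1) show ?thesis
    proof (cases rule: queue_next_cases)
      case stay then show ?thesis using w queue_not_waiting[OF i k] by blast
    next
      case (move m) then show ?thesis using w movedD[OF i'] queue_not_waiting[OF i] by blast
    next
      case new then show ?thesis using w added wfresh by blast
    qed
  next
    case w: (move n)
    note n = movedD[OF i' w]
    from q(1) show ?thesis
    proof (cases rule: queue_next_cases)
      case stay
      have "n = k" using queue_unique[OF i' n(1) k n(4) stay(1)] .
      then show ?thesis using stay(2)[OF n(3)[unfolded \<open>n = k\<close>]] w by simp
    next
      case (move m)
      then show ?thesis using w kn moved_unique_link(2)[OF i'] by blast
    next
      case new
      then show ?thesis using added fresh n by blast
    qed
  next
    case w: new
    then have ko: "k \<noteq> origin G i" using kn by simp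
    from q(1) show ?thesis
    proof (cases rule: queue_next_cases)
      case stay then show ?thesis using w fresh k by blast
    next
      case (move m) then show ?thesis using w fresh movedD[OF i'] by blast
    next
      case new then show ?thesis using ko by simp
    qed
  qed
qed

text \<open>A tag processed after the slot was either processed before, and the old invariant
  separates it from the raw packets, or it has just been combined. In the latter case it was waiting
  for both sources, hence in no raw queue, and has now left both waiting sets. Current arrivals
  differ from either kind.\<close>

lemma processed_raw_next_disjoint:
  assumes i: "i \<in> {1,2}" and k: "k \<in> nodes G" and q: "q \<in> queue s' 0 k"
  shows "l \<in> nodes G \<Longrightarrow> q \<notin> queue s' i l" "q \<notin> waiting s' i"
proof -
  have i': "i \<in> {0,1,2}" and added: "added i = B" "added 0 = combined D"
    using i by (auto simp: added_def)
  have q0: "(\<exists>l\<in>nodes G. q \<in> queue s 0 l) \<or> q \<in> combined D"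
    using queue_next_tags[OF _ k q] added by auto
  have nB: "q \<notin> B"
    using q0 B_fresh queue_known[of 0] combined_waiting[OF i] waiting_known[OF i] by blast
  have nQ: "q \<notin> queue s i l" if "l \<in> nodes G" for l
    using q0 that processed_not_queued[OF i] combined_waiting[OF i] queue_not_waiting[OF i] by blast
  show "l \<in> nodes G \<Longrightarrow> q \<notin> queue s' i l"
    using queue_next_tags[OF i'] added nB nQ by blast
  show "q \<notin> waiting s' i"
    using waiting_next_tags[OF i] nB nQ q0 processed_not_waiting[OF i] by blast
qed

lemma consistent_next: "consistent G (Suc t) s'"
proof -
  have "finite (queue s' i k) \<and> queue s' i k \<subseteq> known_tags (Suc t)"
    if "i \<in> {0,1,2}" "k \<in> nodes G" for i k
  proof
    show "finite (queue s' i k)"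
      unfolding queue_next
      using finite_queue[OF that] finite_moved_in[OF that(1)] finite_added by (auto simp del: finite_UN)
    show "queue s' i k \<subseteq> known_tags (Suc t)"
      using queue_next_tags[OF that] queue_known[OF that(1)] added_known known_tags_Suc by blast
  qed
  moreover have "finite (waiting s' i) \<and> waiting s' i \<subseteq> known_tags (Suc t)" if "i \<in> {1,2}" for i
  proof
    have i': "i \<in> {0,1,2}" using that by auto
    show "finite (waiting s' i)"
      unfolding waiting_next
      using finite_waiting[OF that] finite_moved_in[OF i'] by (auto simp del: finite_UN)
    show "waiting s' i \<subseteq> known_tags (Suc t)"
      using waiting_next_tags[OF that] queue_known[OF i'] waiting_known[OF that] known_tags_Suc
      by blast
  qed
  moreover have "disjoint_family_on (queue s' i) (nodes G)" if "i \<in> {0,1,2}" for i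
    unfolding disjoint_family_on_def using queue_next_disjoint[OF that] by blast
  moreover have "queue s' i (target G i) = {}" for i
    by (simp add: queue_next)
  moreover have "queue s' i k \<inter> waiting s' i = {}" if "i \<in> {1,2}" "k \<in> nodes G" for i k
    using queue_waiting_next_disjoint[OF that] by blast
  moreover have "queue s' 0 k \<inter> ((\<Union>l\<in>nodes G. queue s' i l) \<union> waiting s' i) = {}"
    if "i \<in> {1,2}" "k \<in> nodes G" for i k
    using processed_raw_next_disjoint[OF that] by blast
  ultimately show ?thesis
    unfolding consistent_def by (intro conjI ballI) simp_all
qed

section \<open>Packet counts over one slot\<close>

lemma card_moved_in:
  assumes "i \<in> {0,1,2}"
  shows "card (\<Union>m\<in>nbrs G k. moved D i m k) = (\<Sum>m\<in>nbrs G k. card (moved D i m k))"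
proof (rule card_UN_disjoint)
  show "\<forall>m\<in>nbrs G k. finite (moved D i m k)"
    using finite_moved[OF assms] by (auto simp: nbrs_sym[of k])
  show "\<forall>m\<in>nbrs G k. \<forall>n\<in>nbrs G k. m \<noteq> n \<longrightarrow> moved D i m k \<inter> moved D i n k = {}"
    by (meson assms disjoint_iff moved_unique_link(1))
qed (rule finite_nbrs)

lemma card_moved_out:
  assumes "i \<in> {0,1,2}"
  shows "card (\<Union>l\<in>nbrs G k. moved D i k l) = (\<Sum>l\<in>nbrs G k. card (moved D i k l))"
proof (rule card_UN_disjoint)
  show "\<forall>l\<in>nbrs G k. finite (moved D i k l)"
    using finite_moved[OF assms] by blast
  show "\<forall>l\<in>nbrs G k. \<forall>n\<in>nbrs G k. l \<noteq> n \<longrightarrow> moved D i k l \<inter> moved D i k n = {}"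
    by (meson assms disjoint_iff moved_unique)
qed (rule finite_nbrs)


text \<open>Departures form a subset of the queue, while received and added packets are disjoint
  from it and from each other, so cardinalities simply add. Departures stand on the left to avoid
  truncated subtraction. The target is excluded because packets reaching it leave the queue of their
  class.\<close>

lemma queue_balance:
  assumes i: "i \<in> {0,1,2}" and k: "k \<in> nodes G" "k \<noteq> target G i"
  shows "card (queue s' i k) + (\<Sum>l\<in>nbrs G k. card (moved D i k l)) =
    card (queue s i k) + (\<Sum>m\<in>nbrs G k. card (moved D i m k)) +
    (if k = origin G i then if i = 0 then card (combined D) else a else 0)"
proof -
  let ?Q = "queue s i k" and ?O = "\<Union>l\<in>nbrs G k. moved D i k l"
    and ?I = "\<Union>m\<in>nbrs G k. moved D i m k" and ?N = "if k = origin G i then added i else {}"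
  have OQ: "?O \<subseteq> ?Q" using moved_queue[OF i] by blast
  have fin: "finite ?Q" "finite ?I" "finite ?N"
    using finite_queue[OF i k(1)] finite_moved_in[OF i] finite_added by auto
  have IQ: "?I \<inter> ?Q = {}"
    using movedD[OF i] queue_unique[OF i _ k(1)] by blast
  have IN: "(?Q - ?O \<union> ?I) \<inter> ?N = {}"
    using added_fresh[OF i k(1)] added_fresh[OF i] movedD(1,4)[OF i] by (simp add: disjoint_iff) metis
  have "card (queue s' i k) = card (?Q - ?O \<union> ?I) + card ?N"
    using k(2) fin IN by (simp add: queue_next card_Un_disjoint)
  moreover have "card (?Q - ?O \<union> ?I) = card (?Q - ?O) + card ?I"
    using fin IQ by (intro card_Un_disjoint) auto
  moreover have "card (?Q - ?O) + card ?O = card ?Q"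
    using card_Diff_subset[OF finite_subset[OF OQ fin(1)] OQ] card_mono[OF fin(1) OQ] by simp
  ultimately show ?thesis
    using card_moved_in[OF i] card_moved_out[OF i] card_B
    by (auto simp: added_def)
qed

text \<open>Same count as for a queue, with combinations as the departures. The last summand covers
  a source located at the computation node, whose packets skip the queue.\<close>

lemma waiting_balance:
  assumes i: "i \<in> {1,2}"
  shows "card (waiting s' i) + card (combined D) =
    card (waiting s i) + (\<Sum>m\<in>nbrs G (comp_node G). card (moved D i m (comp_node G))) +
    (if origin G i = comp_node G then a else 0)"
proof -
  let ?n = "comp_node G"
  let ?W = "waiting s i" and ?C = "combined D"
    and ?I = "\<Union>m\<in>nbrs G ?n. moved D i m ?n" and ?N = "if origin G i = ?n then B else {}"
  have i': "i \<in> {0,1,2}" using i by auto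
  have CW: "?C \<subseteq> ?W" using combined_waiting[OF i] .
  have fin: "finite ?W" "finite ?I" "finite ?N"
    using finite_waiting[OF i] finite_moved_in[OF i'] by auto
  have I: "\<exists>l\<in>nodes G. q \<in> queue s i l" if "q \<in> ?I" for q
    using that movedD[OF i'] by blast
  have IW: "?I \<inter> ?W = {}"
    using I queue_not_waiting[OF i] by blast
  have "q \<notin> B" if "q \<in> ?I \<union> ?W" for q
    using that I B_fresh queue_known[OF i'] waiting_known[OF i] by blast
  then have IN: "(?W - ?C \<union> ?I) \<inter> ?N = {}" by auto
  have "card (waiting s' i) = card (?W - ?C \<union> ?I) + card ?N"
    using fin IN by (simp add: waiting_next card_Un_disjoint)
  moreover have "card (?W - ?C \<union> ?I) = card (?W - ?C) + card ?I"
    using fin IW by (intro card_Un_disjoint) auto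
  moreover have "card (?W - ?C) + card ?C = card ?W"
    using card_Diff_subset[OF finite_subset[OF CW fin(1)] CW] card_mono[OF fin(1) CW] by simp
  ultimately show ?thesis
    using card_moved_in[OF i'] card_B by auto
qed

end

section \<open>Time averages\<close>

text \<open>Averages start at slot 0, so increments telescope to \<open>f T - f 0\<close>. At
  \<open>T = 0\<close> the value is 0, which is why the upper bound below asks for
  \<open>0 \<le> C\<close>.\<close>

definition time_avg :: "(nat \<Rightarrow> real) \<Rightarrow> nat \<Rightarrow> real" where
  "time_avg f T = (\<Sum>t<T. f t) / real T"

lemma time_avg_nonneg: "(\<And>t. 0 \<le> f t) \<Longrightarrow> 0 \<le> time_avg f T"
  by (simp add: time_avg_def sum_nonneg)

lemma time_avg_le:
  assumes "\<And>t. f t \<le> C" "0 \<le> C"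
  shows "time_avg f T \<le> C"
proof (cases "T = 0")
  case False
  have "(\<Sum>t<T. f t) \<le> real T * C"
    using sum_bounded_above[of "{..<T}" f C] assms by simp
  with False show ?thesis by (simp add: time_avg_def divide_simps mult.commute)
qed (use assms in \<open>simp add: time_avg_def\<close>)

lemma time_avg_add: "time_avg (\<lambda>t. f t + g t) T = time_avg f T + time_avg g T"
  by (simp add: time_avg_def sum.distrib add_divide_distrib)

lemma time_avg_diff: "time_avg (\<lambda>t. f t - g t) T = time_avg f T - time_avg g T"
  by (simp add: time_avg_def sum_subtractf diff_divide_distrib)

lemma time_avg_sum: "time_avg (\<lambda>t. \<Sum>k\<in>K. f k t) T = (\<Sum>k\<in>K. time_avg (f k) T)"
  unfolding time_avg_def by (subst sum.swap) (simp add: sum_divide_distrib)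

lemma time_avg_const_tendsto:
  assumes "strict_mono r"
  shows "(\<lambda>j. time_avg (\<lambda>t. C) (r j)) \<longlonglongrightarrow> C"
proof (rule tendsto_eventually)
  have "time_avg (\<lambda>t. C) (r j) = C" if "j \<ge> 1" for j
    using that seq_suble[OF assms, of j] by (simp add: time_avg_def)
  then show "\<forall>\<^sub>F j in sequentially. time_avg (\<lambda>t. C) (r j) = C"
    unfolding eventually_sequentially by blast
qed

text \<open>The average telescopes to \<open>(x (r j) - x 0) / r j\<close>, whose numerator is
  bounded and whose denominator is at least \<open>j\<close>. A bound along the subsequence alone
  suffices.\<close>

lemma time_avg_increment_tendsto_0:
  fixes x :: "nat \<Rightarrow> real"
  assumes r: "strict_mono r" and x: "\<And>t. 0 \<le> x t" "\<And>j. x (r j) \<le> K"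
  shows "(\<lambda>j. time_avg (\<lambda>t. x (Suc t) - x t) (r j)) \<longlonglongrightarrow> 0"
proof (rule Lim_null_comparison)
  have "norm (time_avg (\<lambda>t. x (Suc t) - x t) (r j)) \<le> (K + x 0) / real j" if "j \<ge> 1" for j
  proof -
    have "j \<le> r j" by (rule seq_suble[OF r])
    have "norm (time_avg (\<lambda>t. x (Suc t) - x t) (r j)) = \<bar>x (r j) - x 0\<bar> / real (r j)"
      by (simp add: time_avg_def sum_lessThan_telescope)
    also have "\<dots> \<le> (K + x 0) / real j"
      using x(1)[of 0] x(1)[of "r j"] x(2)[of j] that \<open>j \<le> r j\<close> by (intro frac_le) auto
    finally show ?thesis .
  qed
  then show "\<forall>\<^sub>F j in sequentially. norm (time_avg (\<lambda>t. x (Suc t) - x t) (r j)) \<le> (K + x 0) / real j"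
    unfolding eventually_sequentially by blast
  show "(\<lambda>j. (K + x 0) / real j) \<longlonglongrightarrow> 0" by real_asymp
qed

text \<open>If \<open>S\<close> stayed above \<open>2 * B + 1\<close> from some point on, the later
  half of a long horizon alone would already exceed the linear bound on the whole sum.\<close>

lemma bounded_infinitely_often:
  fixes S :: "nat \<Rightarrow> real"
  assumes S: "\<And>t. 0 \<le> S t" and B: "\<forall>\<^sub>F T in sequentially. (\<Sum>t=1..T. S t) \<le> B * real T"
  shows "\<exists>r :: nat \<Rightarrow> nat. strict_mono r \<and> (\<forall>j. S (r j) \<le> 2 * B + 1)"
proof -
  from B obtain T0 where T0: "\<And>T. T \<ge> T0 \<Longrightarrow> (\<Sum>t=1..T. S t) \<le> B * real T"
    unfolding eventually_sequentially by blast
  have "\<exists>t>n. S t \<le> 2 * B + 1" for n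
  proof (rule ccontr)
    assume "\<not> ?thesis"
    then have large: "S t \<ge> 2 * B + 1" if "t > n" for t using that by force
    \<comment> \<open>The window from \<open>m + 1\<close> to \<open>2 * m + 1\<close> then lies
      beyond \<open>n\<close> and ends beyond \<open>T0\<close>. Its \<open>m + 1\<close> terms sum
      to at least \<open>(m + 1) * (2 * B + 1)\<close>, which is more than
      \<open>B * (2 * m + 1)\<close> once \<open>B\<close> is nonnegative.\<close>
    define m where "m = n + T0"
    have "(\<Sum>t\<in>{m+1..2*m+1}. S t) \<ge> real (card {m+1..2*m+1}) * (2 * B + 1)"
      by (rule sum_bounded_below) (use large in \<open>auto simp: m_def\<close>)
    moreover have "(\<Sum>t\<in>{m+1..2*m+1}. S t) \<le> (\<Sum>t=1..2*m+1. S t)"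
      by (rule sum_mono2) (use S in auto)
    moreover have "(\<Sum>t=1..2*m+1. S t) \<le> B * real (2*m+1)"
      by (rule T0) (simp add: m_def)
    ultimately have "real (card {m+1..2*m+1}) * (2 * B + 1) \<le> B * real (2*m+1)" by linarith
    then have "(real m + 1) * (2 * B + 1) \<le> B * (2 * real m + 1)" by (simp add: add.commute)
    moreover have "0 \<le> B"
    proof -
      have "0 \<le> (\<Sum>t=1..T0+1. S t)" using S by (intro sum_nonneg) auto
      also have "\<dots> \<le> B * real (T0 + 1)" by (rule T0) simp
      finally show ?thesis by (simp add: zero_le_mult_iff)
    qed
    ultimately show False by (simp add: algebra_simps)
  qed
  then have "infinite {t. S t \<le> 2 * B + 1}"
    unfolding infinite_nat_iff_unbounded by blast
  then obtain r :: "nat \<Rightarrow> nat" where "strict_mono r" "\<forall>j. r j \<in> {t. S t \<le> 2 * B + 1}"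
    using infinite_enumerate[of "{t. S t \<le> 2 * B + 1}"] by metis
  then show ?thesis by auto
qed

text \<open>Bolzano-Weierstrass applied to one index after another; earlier limits persist under
  further thinning.\<close>

lemma common_convergent_subsequence:
  fixes f :: "'i \<Rightarrow> nat \<Rightarrow> real"
  assumes "finite I" "\<And>i. i \<in> I \<Longrightarrow> bounded (range (f i))"
  shows "\<exists>r :: nat \<Rightarrow> nat. strict_mono r \<and> (\<forall>i\<in>I. convergent (f i \<circ> r))"
  using assms
proof (induction I rule: finite_induct)
  case empty
  show ?case using strict_mono_id by auto
next
  case (insert i I)
  then obtain r where r: "strict_mono r" "\<forall>i\<in>I. convergent (f i \<circ> r)" by blast
  have "bounded (range (f i \<circ> r))"
    by (rule bounded_subset[of "range (f i)"]) (use insert.prems in auto)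
  then obtain l r' where r': "strict_mono r'" "(f i \<circ> r \<circ> r') \<longlonglongrightarrow> l"
    using bounded_imp_convergent_subsequence by blast
  have "convergent (f k \<circ> (r \<circ> r'))" if "k \<in> insert i I" for k
  proof (cases "k = i")
    case True
    then show ?thesis using r'(2) by (auto simp: convergent_def o_assoc)
  next
    case False
    then have "convergent (f k \<circ> r)" using that r by auto
    then show ?thesis using convergent_subseq_convergent[OF _ r'(1)] by (simp add: o_assoc)
  qed
  moreover have "strict_mono (r \<circ> r')" using r(1) r'(1) by (rule strict_mono_o)
  ultimately show ?case by blast
qed

section \<open>Limit flows\<close>

context comp_network
begin

lemma sum_out_eq_sum_in:
  fixes f :: "'v \<Rightarrow> 'v \<Rightarrow> real"
  shows "(\<Sum>m\<in>nodes G. \<Sum>k\<in>nbrs G m. f m k) = (\<Sum>m\<in>nodes G. \<Sum>k\<in>nbrs G m. f k m)"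
proof -
  \<comment> \<open>Writing neighbour sums as sums over all nodes with an edge indicator makes both
    sides double sums over the same set, and the indicator is symmetric.\<close>
  have *: "(\<Sum>k\<in>nbrs G m. g k) = (\<Sum>k\<in>nodes G. if {m, k} \<in> edges G then g k else 0)" for m
    and g :: "'v \<Rightarrow> real"
    by (rule sum.mono_neutral_cong_left) (use finite_nodes nbrs_nodes in \<open>auto simp: nbrs_def\<close>)
  show ?thesis
    unfolding * by (subst sum.swap) (simp add: insert_commute)
qed

text \<open>Net outflows cancel over the whole network. This supplies conservation at a destination,
  where there is no queue and hence no queue balance.\<close>

lemma net_flow_at_sink:
  fixes f :: "'v \<Rightarrow> 'v \<Rightarrow> real"
  assumes b: "b \<in> nodes G"
    and net: "\<And>m. m \<in> nodes G - {b} \<Longrightarrow> (\<Sum>k\<in>nbrs G m. f m k) - (\<Sum>k\<in>nbrs G m. f k m) = g m"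
  shows "(\<Sum>k\<in>nbrs G b. f b k) - (\<Sum>k\<in>nbrs G b. f k b) = - (\<Sum>m\<in>nodes G - {b}. g m)"
proof -
  let ?net = "\<lambda>m. (\<Sum>k\<in>nbrs G m. f m k) - (\<Sum>k\<in>nbrs G m. f k m)"
  have "0 = (\<Sum>m\<in>nodes G. ?net m)" using sum_out_eq_sum_in[of f] by (simp add: sum_subtractf)
  also have "\<dots> = ?net b + (\<Sum>m\<in>nodes G - {b}. ?net m)"
    using finite_nodes b by (rule sum.remove)
  finally show ?thesis using net by simp
qed

text \<open>The deterministic core. \<open>F\<close>, \<open>c\<close>, \<open>q\<close> and
  \<open>w\<close> stand for the expected transfers, combinations, queue lengths and waiting packets
  in each slot; only their balances, bounds and linear growth enter.\<close>

lemma fluid_limit: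
  fixes F :: "nat \<Rightarrow> nat \<Rightarrow> 'v \<Rightarrow> 'v \<Rightarrow> real" and c :: "nat \<Rightarrow> real"
    and q :: "nat \<Rightarrow> nat \<Rightarrow> 'v \<Rightarrow> real" and w :: "nat \<Rightarrow> nat \<Rightarrow> real"
  assumes F_nonneg: "\<And>t i m k. 0 \<le> F t i m k"
    and F_cap: "\<And>t m k. {m, k} \<in> edges G \<Longrightarrow> (\<Sum>i\<in>{0,1,2}. F t i m k + F t i k m) \<le> edge_cap G {m, k}"
    and F_target: "\<And>t i k. i \<in> {0,1,2} \<Longrightarrow> k \<in> nbrs G (target G i) \<Longrightarrow> F t i (target G i) k = 0"
    and c_cap: "\<And>t. c t \<le> comp_cap G"
    and q_nonneg: "\<And>t i k. 0 \<le> q t i k" and w_nonneg: "\<And>t i. 0 \<le> w t i"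
    and q_balance: "\<And>t i k. i \<in> {0,1,2} \<Longrightarrow> k \<in> nodes G \<Longrightarrow> k \<noteq> target G i \<Longrightarrow>
      q (Suc t) i k + (\<Sum>l\<in>nbrs G k. F t i k l) = q t i k + (\<Sum>m\<in>nbrs G k. F t i m k) +
        (if k = origin G i then if i = 0 then c t else rate else 0)"
    and w_balance: "\<And>t i. i \<in> {1,2} \<Longrightarrow>
      w (Suc t) i + c t = w t i + (\<Sum>m\<in>nbrs G (comp_node G). F t i m (comp_node G)) +
        (if origin G i = comp_node G then rate else 0)"
    and q_stable: "\<And>i k. i \<in> {0,1,2} \<Longrightarrow> k \<in> nodes G \<Longrightarrow>
      \<exists>B. \<forall>\<^sub>F T in sequentially. (\<Sum>t=1..T. q t i k) \<le> B * real T"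
    and w_stable: "\<And>i. i \<in> {1,2} \<Longrightarrow>
      \<exists>B. \<forall>\<^sub>F T in sequentially. (\<Sum>t=1..T. w t i) \<le> B * real T"
  shows "[rate, rate, rate] \<in> flow_region G
           [(source1 G, comp_node G), (source2 G, comp_node G), (comp_node G, dest G)]
         \<and> rate \<le> comp_cap G"
proof -
  let ?n = "comp_node G"
  \<comment> \<open>One sum dominates all queue lengths and the backlog of the first source, so one
    sequence of slots keeps all of them bounded.\<close>
  define S where "S t = (\<Sum>(i,k)\<in>{0,1,2} \<times> nodes G. q t i k) + w t 1" for t
  have S_nonneg: "0 \<le> S t" for t
    unfolding S_def using q_nonneg w_nonneg by (intro add_nonneg_nonneg sum_nonneg) auto
  have "\<forall>p\<in>{0,1,2} \<times> nodes G. \<exists>B. \<forall>\<^sub>F T in sequentially.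
      (\<Sum>t=1..T. q t (fst p) (snd p)) \<le> B * real T"
    using q_stable by auto
  then obtain Bq where Bq: "\<And>p. p \<in> {0,1,2} \<times> nodes G \<Longrightarrow>
      \<forall>\<^sub>F T in sequentially. (\<Sum>t=1..T. q t (fst p) (snd p)) \<le> Bq p * real T"
    by metis
  obtain Bw where Bw: "\<forall>\<^sub>F T in sequentially. (\<Sum>t=1..T. w t 1) \<le> Bw * real T"
    using w_stable[of 1] by auto
  define B where "B = (\<Sum>p\<in>{0,1,2} \<times> nodes G. Bq p) + Bw"
  have "\<forall>\<^sub>F T in sequentially. \<forall>p\<in>{0,1,2} \<times> nodes G.
      (\<Sum>t=1..T. q t (fst p) (snd p)) \<le> Bq p * real T"
    using Bq finite_nodes by (intro eventually_ball_finite) auto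
  then have "\<forall>\<^sub>F T in sequentially. (\<Sum>t=1..T. S t) \<le> B * real T"
    using Bw
  proof eventually_elim
    case (elim T)
    have "(\<Sum>t=1..T. S t) =
        (\<Sum>p\<in>{0,1,2} \<times> nodes G. \<Sum>t=1..T. q t (fst p) (snd p)) + (\<Sum>t=1..T. w t 1)"
      unfolding S_def sum.distrib by (subst sum.swap) (simp add: case_prod_beta)
    also have "\<dots> \<le> (\<Sum>p\<in>{0,1,2} \<times> nodes G. Bq p * real T) + Bw * real T"
      using elim by (intro add_mono sum_mono) auto
    also have "\<dots> = B * real T"
      by (simp only: B_def distrib_right sum_distrib_right)
    finally show ?case .
  qed
  then obtain r0 :: "nat \<Rightarrow> nat" where r0: "strict_mono r0" "\<And>j. S (r0 j) \<le> 2 * B + 1"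
    using bounded_infinitely_often[of S B] S_nonneg by auto
  let ?E = "{(m, k). {m, k} \<in> edges G}"
  have finE: "finite ({0,1,2::nat} \<times> ?E)"
    using finite_subset[of ?E "nodes G \<times> nodes G"] finite_nodes edge_nodes by auto
  define f where "f = (\<lambda>(i, m, k) T. time_avg (\<lambda>t. F t i m k) T)"
  have cap_nonneg: "0 \<le> edge_cap G e" if "e \<in> edges G" for e
    using network that by (auto simp: computation_network_def)
  have F_le: "F t i m k \<le> edge_cap G {m, k}" if "i \<in> {0,1,2}" "{m, k} \<in> edges G" for t i m k
  proof -
    have "F t i m k \<le> F t i m k + F t i k m" using F_nonneg by simp
    also have "\<dots> \<le> (\<Sum>i\<in>{0,1,2}. F t i m k + F t i k m)"
      using that(1) by (intro member_le_sum) (auto intro: add_nonneg_nonneg F_nonneg)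
    also note F_cap[OF that(2)]
    finally show ?thesis .
  qed
  have "\<exists>r :: nat \<Rightarrow> nat. strict_mono r \<and> (\<forall>p\<in>{0,1,2} \<times> ?E. convergent ((\<lambda>j. f p (r0 j)) \<circ> r))"
  proof (rule common_convergent_subsequence[OF finE, of "\<lambda>p j. f p (r0 j)"])
    fix p :: "nat \<times> 'v \<times> 'v" assume p: "p \<in> {0,1,2} \<times> ?E"
    obtain i m k where [simp]: "p = (i, m, k)" by (cases p)
    have "norm (f p (r0 j)) \<le> edge_cap G {m, k}" for j
      using p F_le F_nonneg cap_nonneg
      by (auto simp: f_def time_avg_nonneg intro!: time_avg_le)
    then show "bounded (range (\<lambda>j. f p (r0 j)))"
      by (auto simp: bounded_iff)
  qed
  then obtain r1 :: "nat \<Rightarrow> nat" where r1: "strict_mono r1"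
    "\<And>p. p \<in> {0,1,2} \<times> ?E \<Longrightarrow> convergent ((\<lambda>j. f p (r0 j)) \<circ> r1)" by blast
  \<comment> \<open>Thinning \<open>r0\<close> keeps the bound on \<open>S\<close> while all
    averaged link flows now converge.\<close>
  define r where "r = r0 \<circ> r1"
  have r: "strict_mono r" unfolding r_def using r0(1) r1(1) by (rule strict_mono_o)
  have Sr: "S (r j) \<le> 2 * B + 1" for j by (simp add: r_def r0)
  define \<phi> where "\<phi> i m k = lim (\<lambda>j. time_avg (\<lambda>t. F t i m k) (r j))" for i m k
  have \<phi>: "(\<lambda>j. time_avg (\<lambda>t. F t i m k) (r j)) \<longlonglongrightarrow> \<phi> i m k"
    if "i \<in> {0,1,2}" "{m, k} \<in> edges G" for i m k
    using r1(2)[of "(i,m,k)"] that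
    unfolding \<phi>_def by (simp add: f_def r_def o_def convergent_LIMSEQ_iff)
  define inflow outflow where "inflow i k = (\<Sum>m\<in>nbrs G k. \<phi> i m k)"
    and "outflow i k = (\<Sum>m\<in>nbrs G k. \<phi> i k m)" for i k
  have in_lim: "(\<lambda>j. time_avg (\<lambda>t. \<Sum>m\<in>nbrs G k. F t i m k) (r j)) \<longlonglongrightarrow> inflow i k"
    and out_lim: "(\<lambda>j. time_avg (\<lambda>t. \<Sum>m\<in>nbrs G k. F t i k m) (r j)) \<longlonglongrightarrow> outflow i k"
    if "i \<in> {0,1,2}" for i k
    unfolding time_avg_sum inflow_def outflow_def
    by (intro tendsto_sum \<phi> that; simp add: nbrs_def insert_commute)+
  have q_lim: "(\<lambda>j. time_avg (\<lambda>t. q (Suc t) i k - q t i k) (r j)) \<longlonglongrightarrow> 0"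
    if "i \<in> {0,1,2}" "k \<in> nodes G" for i k
  proof (rule time_avg_increment_tendsto_0[OF r])
    fix j
    have "q (r j) i k \<le> (\<Sum>(i,k)\<in>{0,1,2} \<times> nodes G. q (r j) i k)"
      using that finite_nodes q_nonneg
        member_le_sum[of "(i,k)" "{0,1,2} \<times> nodes G" "\<lambda>(i,k). q (r j) i k"] by auto
    also have "\<dots> \<le> S (r j)" using w_nonneg by (simp add: S_def)
    finally show "q (r j) i k \<le> 2 * B + 1" using Sr[of j] by linarith
  qed (rule q_nonneg)
  have w_lim: "(\<lambda>j. time_avg (\<lambda>t. w (Suc t) 1 - w t 1) (r j)) \<longlonglongrightarrow> 0"
  proof (rule time_avg_increment_tendsto_0[OF r])
    fix j
    have "w (r j) 1 \<le> S (r j)"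
      unfolding S_def using q_nonneg by (auto intro!: sum_nonneg)
    then show "w (r j) 1 \<le> 2 * B + 1" using Sr[of j] by linarith
  qed (rule w_nonneg)
  \<comment> \<open>The limit \<open>a\<close> of the external input is a parameter because for
    class 0 it is the limiting combination rate, which is identified only after the raw classes are
    settled.\<close>
  have net_eq: "outflow i k - inflow i k = a"
    if i: "i \<in> {0,1,2}" and k: "k \<in> nodes G" "k \<noteq> target G i"
      and a: "(\<lambda>j. time_avg (\<lambda>t. if k = origin G i then if i = 0 then c t else rate else 0) (r j)) \<longlonglongrightarrow> a"
    for i k a
  proof -
    let ?x = "\<lambda>t. if k = origin G i then if i = 0 then c t else rate else 0"
    have eq: "(\<Sum>m\<in>nbrs G k. F t i k m) - (\<Sum>m\<in>nbrs G k. F t i m k) = ?x t - (q (Suc t) i k - q t i k)" for t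
      using q_balance[OF i k, of t] by linarith
    have "time_avg (\<lambda>t. \<Sum>m\<in>nbrs G k. F t i k m) T - time_avg (\<lambda>t. \<Sum>m\<in>nbrs G k. F t i m k) T
        = time_avg ?x T - time_avg (\<lambda>t. q (Suc t) i k - q t i k) T" for T
      unfolding time_avg_diff[of _ "\<lambda>t. q (Suc t) i k - q t i k", symmetric] eq[symmetric]
      by (rule time_avg_diff[symmetric])
    moreover have "(\<lambda>j. time_avg ?x (r j) - time_avg (\<lambda>t. q (Suc t) i k - q t i k) (r j)) \<longlonglongrightarrow> a - 0"
      by (intro tendsto_diff a q_lim i k)
    ultimately show ?thesis
      using LIMSEQ_unique[OF tendsto_diff[OF out_lim[OF i] in_lim[OF i], of k k]] by simp
  qed
  have raw_net: "outflow i k - inflow i k = (if k = origin G i then rate else 0)"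
    if i: "i \<in> {1,2}" and k: "k \<in> nodes G" "k \<noteq> target G i" for i k
  proof (rule net_eq[OF _ k])
    show "i \<in> {0,1,2}" using i by auto
    have "i \<noteq> 0" using i by auto
    then show "(\<lambda>j. time_avg (\<lambda>t. if k = origin G i then if i = 0 then c t else rate else 0) (r j))
        \<longlonglongrightarrow> (if k = origin G i then rate else 0)"
      using time_avg_const_tendsto[OF r] by simp
  qed
  have no_out: "\<phi> i (target G i) k = 0" if "i \<in> {0,1,2}" "k \<in> nbrs G (target G i)" for i k
    unfolding \<phi>_def using F_target[OF that] by (simp add: time_avg_def)
  have sink: "outflow i (target G i) - inflow i (target G i) =
      - (if target G i = origin G i then 0 else a)"
    if "i \<in> {0,1,2}" and net: "\<And>k. k \<in> nodes G \<Longrightarrow> k \<noteq> target G i \<Longrightarrow>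
       outflow i k - inflow i k = (if k = origin G i then a else 0)" for i a
  proof -
    have "outflow i (target G i) - inflow i (target G i) =
       - (\<Sum>m\<in>nodes G - {target G i}. if m = origin G i then a else 0)"
      unfolding outflow_def inflow_def
      by (rule net_flow_at_sink) (use net special_nodes in \<open>auto simp: outflow_def inflow_def\<close>)
    also have "\<dots> = - (if target G i = origin G i then 0 else a)"
      using finite_nodes special_nodes by (auto simp: sum.delta)
    finally show ?thesis .
  qed
  \<comment> \<open>Nothing leaves the target, so its inflow is the whole rate when the first source
    lies elsewhere. Otherwise the net inflow is 0 and the arrivals occur at the node itself.\<close>
  have inflow_comp: "inflow 1 ?n + (if origin G 1 = ?n then rate else 0) = rate"
  proof -
    have "outflow 1 (target G 1) = 0"
      unfolding outflow_def using no_out[of 1] by simp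
    then show ?thesis
      using sink[of 1 rate] raw_net[of 1] by (auto simp: target_def split: if_splits)
  qed
  \<comment> \<open>In the waiting balance of source 1 the averaged increments vanish, so
    combinations happen at the rate at which raw packets reach the computation node. This also fixes
    the input rate of class 0.\<close>
  have c_lim: "(\<lambda>j. time_avg c (r j)) \<longlonglongrightarrow> rate"
  proof -
    let ?a = "if origin G 1 = ?n then rate else 0"
    have c_eq: "c t = (\<Sum>m\<in>nbrs G ?n. F t 1 m ?n) + ?a - (w (Suc t) 1 - w t 1)" for t
      using w_balance[of 1 t] by simp
    have "time_avg c T = time_avg (\<lambda>t. \<Sum>m\<in>nbrs G ?n. F t 1 m ?n) T + time_avg (\<lambda>t. ?a) T
        - time_avg (\<lambda>t. w (Suc t) 1 - w t 1) T" for T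
      unfolding time_avg_diff[symmetric] time_avg_add[symmetric]
      by (rule arg_cong[where f = "\<lambda>g. time_avg g T"]) (simp add: fun_eq_iff c_eq)
    moreover have "(\<lambda>j. time_avg (\<lambda>t. \<Sum>m\<in>nbrs G ?n. F t 1 m ?n) (r j) + time_avg (\<lambda>t. ?a) (r j)
        - time_avg (\<lambda>t. w (Suc t) 1 - w t 1) (r j)) \<longlonglongrightarrow> inflow 1 ?n + ?a - 0"
      by (intro tendsto_diff tendsto_add time_avg_const_tendsto r in_lim w_lim) simp
    ultimately show ?thesis using inflow_comp by simp
  qed
  have rate_le: "rate \<le> comp_cap G"
  proof (rule LIMSEQ_le_const2[OF c_lim])
    have "0 \<le> comp_cap G" using network by (simp add: computation_network_def)
    then show "\<exists>N. \<forall>j\<ge>N. time_avg c (r j) \<le> comp_cap G" using time_avg_le c_cap by blast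
  qed
  have net: "outflow i k - inflow i k = (if k = origin G i then rate else 0)"
    if i: "i \<in> {0,1,2}" and k: "k \<in> nodes G" "k \<noteq> target G i" for i k
  proof (rule net_eq[OF i k])
    show "(\<lambda>j. time_avg (\<lambda>t. if k = origin G i then if i = 0 then c t else rate else 0) (r j))
        \<longlonglongrightarrow> (if k = origin G i then rate else 0)"
      using c_lim time_avg_const_tendsto[OF r]
      by (cases "k = origin G i"; cases "i = 0") simp_all
  qed
  have \<phi>_nonneg: "0 \<le> \<phi> i m k" if "i \<in> {0,1,2}" "{m, k} \<in> edges G" for i m k
    by (rule LIMSEQ_le_const[OF \<phi>[OF that]]) (simp add: time_avg_nonneg F_nonneg)
  have \<phi>_cap: "(\<Sum>i\<in>{0,1,2}. \<phi> i m k + \<phi> i k m) \<le> edge_cap G {m, k}" if e: "{m, k} \<in> edges G" for m k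
  proof (rule LIMSEQ_le_const2)
    have e': "{k, m} \<in> edges G" using e by (simp add: insert_commute)
    show "(\<lambda>j. time_avg (\<lambda>t. \<Sum>i\<in>{0,1,2}. F t i m k + F t i k m) (r j))
        \<longlonglongrightarrow> (\<Sum>i\<in>{0,1,2}. \<phi> i m k + \<phi> i k m)"
      unfolding time_avg_sum time_avg_add by (intro tendsto_sum tendsto_add \<phi> e e')
    show "\<exists>N. \<forall>j\<ge>N. time_avg (\<lambda>t. \<Sum>i\<in>{0,1,2}. F t i m k + F t i k m) (r j) \<le> edge_cap G {m, k}"
      by (intro exI allI impI time_avg_le F_cap cap_nonneg e)
  qed
  \<comment> \<open>Commodities 0, 1, 2 of the flow region are the packet classes 1, 2, 0.\<close>
  define cls where "cls j = (if j = (0::nat) then 1 else if j = 1 then 2 else 0 :: nat)" for j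
  \<comment> \<open>A commodity whose source is its destination must carry no flow, so its limit
    flow is dropped; this can only lower the load on the links.\<close>
  define g where "g j m k = (if origin G (cls j) = target G (cls j) then 0 else \<phi> (cls j) m k)" for j m k
  let ?cs = "[(source1 G, ?n), (source2 G, ?n), (?n, dest G)]"
  have cls: "cls j \<in> {0,1,2}" for j by (simp add: cls_def)
  have less3: "j < 3 \<longleftrightarrow> j = 0 \<or> j = 1 \<or> j = 2" for j :: nat by auto
  have cs: "?cs ! j = (origin G (cls j), target G (cls j)) \<and> [rate, rate, rate] ! j = rate" if "j < 3" for j
    using that unfolding less3 by (auto simp: cls_def origin_def target_def)
  have g_nonneg: "0 \<le> g j m k" if "{m, k} \<in> edges G" for j m k
    using \<phi>_nonneg[OF cls that] by (simp add: g_def)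
  have g_cap: "(\<Sum>j<3. g j m k + g j k m) \<le> edge_cap G {m, k}" if e: "{m, k} \<in> edges G" for m k
  proof -
    have e': "{k, m} \<in> edges G" using e by (simp add: insert_commute)
    have "(\<Sum>j<3. g j m k + g j k m) \<le> (\<Sum>j<3. \<phi> (cls j) m k + \<phi> (cls j) k m)"
      using \<phi>_nonneg[OF cls e] \<phi>_nonneg[OF cls e'] by (intro sum_mono add_mono) (auto simp: g_def)
    also have "\<dots> = (\<Sum>i\<in>{0,1,2}. \<phi> i m k + \<phi> i k m)"
      by (simp add: cls_def eval_nat_numeral)
    finally show ?thesis using \<phi>_cap[OF e] by linarith
  qed
  have g_net: "(\<Sum>k\<in>nbrs G m. g j m k) - (\<Sum>k\<in>nbrs G m. g j k m) =
      (if m = origin G (cls j) then rate else if m = target G (cls j) then - rate else 0)"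
    if "m \<in> nodes G" "origin G (cls j) \<noteq> target G (cls j)" for j m
    using that net[OF cls that(1)] sink[OF cls net[OF cls]]
    by (auto simp: g_def outflow_def inflow_def)
  have "[rate, rate, rate] \<in> flow_region G ?cs"
    unfolding flow_region_def mem_Collect_eq
  proof (intro conjI exI[of _ g])
    show "\<forall>j<length ?cs. let a = fst (?cs ! j); b = snd (?cs ! j) in
       if a = b then \<forall>m k. {m, k} \<in> edges G \<longrightarrow> g j m k = 0
       else (\<forall>m\<in>nodes G. (\<Sum>k\<in>nbrs G m. g j m k) - (\<Sum>k\<in>nbrs G m. g j k m) =
           (if m = a then [rate, rate, rate] ! j else if m = b then - ([rate, rate, rate] ! j) else 0)) \<and>
         (\<forall>k\<in>nbrs G b. g j b k = 0)"
    proof (intro allI impI)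
      fix j assume "j < length ?cs"
      then have "j < 3" by simp
      then show "let a = fst (?cs ! j); b = snd (?cs ! j) in
       if a = b then \<forall>m k. {m, k} \<in> edges G \<longrightarrow> g j m k = 0
       else (\<forall>m\<in>nodes G. (\<Sum>k\<in>nbrs G m. g j m k) - (\<Sum>k\<in>nbrs G m. g j k m) =
           (if m = a then [rate, rate, rate] ! j else if m = b then - ([rate, rate, rate] ! j) else 0)) \<and>
         (\<forall>k\<in>nbrs G b. g j b k = 0)"
        using cs[of j] g_net[of _ j] no_out[OF cls] by (simp add: Let_def g_def)
    qed
  qed (use g_nonneg g_cap in \<open>simp_all add: numeral_3_eq_3\<close>)
  with rate_le show ?thesis by blast
qed

end

section \<open>Expected balance along a run\<close>

instance tag :: countable
  by countable_datatype

section \<open>From random sets and extended expectations to real averages\<close>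

lemma measurable_card_countable:
  fixes S :: "'a \<Rightarrow> 'b::countable set"
  assumes S: "\<And>q. {x \<in> space M. q \<in> S x} \<in> sets M"
  shows "(\<lambda>x. card (S x)) \<in> measurable M (count_space UNIV)"
proof -
  \<comment> \<open>The injection \<open>to_nat\<close> preserves cardinality and reduces the claim
    to random sets of naturals; a number outside its range gives the empty event.\<close>
  have "{x \<in> space M. n \<in> to_nat ` S x} \<in> sets M" for n
  proof (cases "n \<in> range (to_nat :: 'b \<Rightarrow> nat)")
    case True
    then obtain q :: 'b where "n = to_nat q" by blast
    then show ?thesis using S[of q] by (simp add: inj_image_mem_iff)
  next
    case False
    then have "{x \<in> space M. n \<in> to_nat ` S x} = {}" by blast
    then show ?thesis by (metis sets.empty_sets)
  qed
  then have "(\<lambda>x. card (to_nat ` S x)) \<in> measurable M (count_space UNIV)"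
    by (rule measurable_card)
  then show ?thesis by (simp add: card_image)
qed

text \<open>A finite constant strictly above the limsup eventually bounds the averages.
  Integrability turns the extended expectations into real ones.\<close>

lemma strongly_stable_linear_bound:
  fixes L :: "nat \<Rightarrow> 'a \<Rightarrow> nat"
  assumes stable: "strongly_stable M L" and L: "\<And>t. integrable M (\<lambda>x. real (L t x))"
  shows "\<exists>B. \<forall>\<^sub>F T in sequentially. (\<Sum>t=1..T. \<integral>x. real (L t x) \<partial>M) \<le> B * real T"
proof -
  have nn: "(\<integral>\<^sup>+ x. of_nat (L t x) \<partial>M) = ennreal (\<integral>x. real (L t x) \<partial>M)" for t
    using nn_integral_eq_integral[OF L[of t]] by (simp add: ennreal_of_nat_eq_real_of_nat)
  let ?a = "\<lambda>T. (\<Sum>t=1..T. \<integral>\<^sup>+ x. of_nat (L t x) \<partial>M) / of_nat T :: ennreal"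
  obtain C where C: "limsup ?a < C" "C < \<infinity>"
    using dense stable unfolding strongly_stable_def by blast
  from C(2) obtain B where B: "C = ennreal B" "0 \<le> B"
    by (cases C) auto
  \<comment> \<open>The condition on \<open>T\<close> keeps the divisor positive when the quotient
    is moved to the reals.\<close>
  have "\<forall>\<^sub>F T in sequentially. ?a T < C \<and> 1 \<le> T"
    using Limsup_lessD[OF C(1)] eventually_ge_at_top by (rule eventually_conj)
  then have "\<forall>\<^sub>F T in sequentially. (\<Sum>t=1..T. \<integral>x. real (L t x) \<partial>M) \<le> B * real T"
  proof eventually_elim
    case (elim T)
    have "?a T = (\<Sum>t=1..T. ennreal (\<integral>x. real (L t x) \<partial>M)) / ennreal (real T)"
      unfolding nn by (simp only: ennreal_of_nat_eq_real_of_nat)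
    also have "\<dots> = ennreal ((\<Sum>t=1..T. \<integral>x. real (L t x) \<partial>M) / real T)"
      using elim by (simp add: sum_ennreal divide_ennreal sum_nonneg)
    finally have "ennreal ((\<Sum>t=1..T. \<integral>x. real (L t x) \<partial>M) / real T) = ?a T" ..
    also have "\<dots> < ennreal B" using elim B by simp
    finally have "(\<Sum>t=1..T. \<integral>x. real (L t x) \<partial>M) / real T \<le> B"
      using B(2) by (simp add: ennreal_less_iff sum_nonneg)
    then show ?case using elim by (simp add: divide_simps)
  qed
  then show ?thesis by blast
qed

locale network_run = comp_network G for G :: "'v network" +
  fixes M :: "'a measure" and A :: "nat \<Rightarrow> 'a \<Rightarrow> nat" and rate :: real
    and \<xi> :: "'a \<Rightarrow> 'w" and p :: "('w, 'v) policy" and s0 :: "'v state"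
  assumes arrivals: "query_arrivals M A rate"
    and initial: "initial_state G s0"
    and policy: "p \<in> Pi_C G"
    and measurable: "measurable_decisions G M A \<xi> p s0"
    and stable: "stable_system G M A \<xi> p s0"
begin

abbreviation S :: "nat \<Rightarrow> 'a \<Rightarrow> 'v state" where
  "S t x \<equiv> state_at G p s0 (\<xi> x) (\<lambda>u. A u x) t"

abbreviation D :: "nat \<Rightarrow> 'a \<Rightarrow> 'v decision" where
  "D t x \<equiv> decision_at G p s0 (\<xi> x) (\<lambda>u. A u x) t"

sublocale prob_space M
  using arrivals by (simp add: query_arrivals_def)

lemma S_0: "S 0 x = s0"
  by (simp add: state_at_def)

lemma S_Suc: "S (Suc t) x = next_state G (S t x) (D t x) (Arrival t ` {..<A t x})"
  by (simp add: state_at_def decision_at_def)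

lemma feasible_D: "feasible G (S t x) (D t x)"
proof -
  have "history G p s0 (\<xi> x) (\<lambda>u. A u x) t \<noteq> []" by (cases t) auto
  then show ?thesis
    using policy by (simp add: Pi_C_def state_at_def decision_at_def)
qed

text \<open>Consistency propagates along each sample path, so the balances hold for every outcome
  \<open>x\<close>, with \<open>A t x\<close> as the number of arrivals.\<close>

lemma slot: "slot G (S t x) (D t x) t"
proof (induction t)
  case 0
  show ?case
    using initial_state_consistent[OF initial] feasible_D[of x 0] network
    by unfold_locales (simp_all add: S_0)
next
  case (Suc t)
  show ?case
    using slot.consistent_next[OF Suc] feasible_D[of x "Suc t"] network
    by unfold_locales (simp_all add: S_Suc)
qed

section \<open>Random flows and queue lengths: balance and integrability\<close>

definition flow :: "nat \<Rightarrow> nat \<Rightarrow> 'v \<Rightarrow> 'v \<Rightarrow> 'a \<Rightarrow> real" where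
  "flow t i m k x = real (card (moved (D t x) i m k))"

definition comb :: "nat \<Rightarrow> 'a \<Rightarrow> real" where
  "comb t x = real (card (combined (D t x)))"

definition qlen :: "nat \<Rightarrow> nat \<Rightarrow> 'v \<Rightarrow> 'a \<Rightarrow> real" where
  "qlen t i k x = real (card (queue (S t x) i k))"

definition wlen :: "nat \<Rightarrow> nat \<Rightarrow> 'a \<Rightarrow> real" where
  "wlen t i x = real (card (waiting (S t x) i))"

lemma flow_cap:
  "{m, k} \<in> edges G \<Longrightarrow> (\<Sum>i\<in>{0,1,2}. flow t i m k x + flow t i k m x) \<le> edge_cap G {m, k}"
  unfolding flow_def by (rule slot.link_capacity[OF slot])

lemma flow_le:
  assumes "i \<in> {0,1,2}" "{m, k} \<in> edges G"
  shows "flow t i m k x \<le> edge_cap G {m, k}"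
proof -
  have "flow t i m k x \<le> flow t i m k x + flow t i k m x" by (simp add: flow_def)
  also have "\<dots> \<le> (\<Sum>i\<in>{0,1,2}. flow t i m k x + flow t i k m x)"
    using assms(1) by (intro member_le_sum) (auto simp: flow_def)
  also note flow_cap[OF assms(2)]
  finally show ?thesis .
qed

lemma integrable_flow:
  assumes "i \<in> {0,1,2}" "{m, k} \<in> edges G"
  shows "integrable M (flow t i m k)"
proof (rule integrable_const_bound)
  show "AE x in M. norm (flow t i m k x) \<le> edge_cap G {m, k}"
    using flow_le[OF assms] by (simp add: flow_def)
  have "(\<lambda>x. card (moved (D t x) i m k)) \<in> measurable M (count_space UNIV)"
    by (rule measurable_card_countable)
      (use measurable assms in \<open>auto simp: measurable_decisions_def Let_def\<close>)
  then show "flow t i m k \<in> borel_measurable M"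
    unfolding flow_def by (rule measurable_compose) simp
qed

lemma comb_le: "comb t x \<le> comp_cap G"
  unfolding comb_def by (rule slot.card_combined_le[OF slot])

lemma integrable_comb: "integrable M (comb t)"
proof (rule integrable_const_bound)
  show "AE x in M. norm (comb t x) \<le> comp_cap G"
    using comb_le by (simp add: comb_def)
  have "(\<lambda>x. card (combined (D t x))) \<in> measurable M (count_space UNIV)"
    by (rule measurable_card_countable)
      (use measurable in \<open>simp add: measurable_decisions_def Let_def\<close>)
  then show "comb t \<in> borel_measurable M"
    unfolding comb_def by (rule measurable_compose) simp
qed

lemma arrivals_integral:
  shows "integrable M (\<lambda>x. real (A t x))" "(\<integral>x. real (A t x) \<partial>M) = rate"
  using arrivals by (auto simp: query_arrivals_def has_bochner_integral_iff)

text \<open>Solved for the new length, so that it serves as the recursion for integrability.\<close>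

lemma qlen_balance:
  assumes "i \<in> {0,1,2}" "k \<in> nodes G" "k \<noteq> target G i"
  shows "qlen (Suc t) i k x = qlen t i k x + (\<Sum>m\<in>nbrs G k. flow t i m k x) +
    (if k = origin G i then if i = 0 then comb t x else real (A t x) else 0)
    - (\<Sum>l\<in>nbrs G k. flow t i k l x)"
  using slot.queue_balance[OF slot[of x t] assms, of "A t x", THEN arg_cong[where f = real]]
  by (cases "k = origin G i"; cases "i = 0") (simp_all add: qlen_def flow_def comb_def S_Suc)

lemma wlen_balance:
  assumes "i \<in> {1,2}"
  shows "wlen (Suc t) i x = wlen t i x + (\<Sum>m\<in>nbrs G (comp_node G). flow t i m (comp_node G) x) +
    (if origin G i = comp_node G then real (A t x) else 0) - comb t x"
  using slot.waiting_balance[OF slot[of x t] assms, of "A t x", THEN arg_cong[where f = real]]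
  by (simp add: wlen_def flow_def comb_def S_Suc split: if_splits)

lemma flow_sums:
  assumes i: "i \<in> {0,1,2}"
  shows "integrable M (\<lambda>x. \<Sum>m\<in>nbrs G k. flow t i m k x)"
    and "integrable M (\<lambda>x. \<Sum>l\<in>nbrs G k. flow t i k l x)"
    and "(\<integral>x. (\<Sum>m\<in>nbrs G k. flow t i m k x) \<partial>M) = (\<Sum>m\<in>nbrs G k. integral\<^sup>L M (flow t i m k))"
    and "(\<integral>x. (\<Sum>l\<in>nbrs G k. flow t i k l x) \<partial>M) = (\<Sum>l\<in>nbrs G k. integral\<^sup>L M (flow t i k l))"
proof -
  have e: "{l, k} \<in> edges G" "{k, l} \<in> edges G" if "l \<in> nbrs G k" for l
    using that by (auto simp: nbrs_def insert_commute)
  note int = integrable_flow[OF i e(1)] integrable_flow[OF i e(2)]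
  show "integrable M (\<lambda>x. \<Sum>m\<in>nbrs G k. flow t i m k x)"
    "integrable M (\<lambda>x. \<Sum>l\<in>nbrs G k. flow t i k l x)"
    by (intro Bochner_Integration.integrable_sum int; assumption)+
  show "(\<integral>x. (\<Sum>m\<in>nbrs G k. flow t i m k x) \<partial>M) = (\<Sum>m\<in>nbrs G k. integral\<^sup>L M (flow t i m k))"
    "(\<integral>x. (\<Sum>l\<in>nbrs G k. flow t i k l x) \<partial>M) = (\<Sum>l\<in>nbrs G k. integral\<^sup>L M (flow t i k l))"
    by (intro Bochner_Integration.integral_sum int; assumption)+
qed

text \<open>The initial length is constant, and the balance expresses each later length through
  integrable terms; measurability comes along the same way. The target has no balance, but its queue
  is always empty.\<close>

lemma integrable_qlen:
  assumes "i \<in> {0,1,2}" "k \<in> nodes G"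
  shows "integrable M (qlen t i k)"
proof (cases "k = target G i")
  case True
  then have "qlen t i k = (\<lambda>x. 0)"
    using slot.queue_target[OF slot assms(1)] by (simp add: qlen_def fun_eq_iff)
  then show ?thesis by simp
next
  case False
  show ?thesis
  proof (induction t)
    case 0
    show ?case by (simp add: qlen_def S_0)
  next
    case (Suc t)
    then show ?case
      unfolding qlen_balance[OF assms False, abs_def]
      using integrable_comb[of t] arrivals_integral(1)[of t] assms(1)
      by (cases "k = origin G i"; cases "i = 0")
        (auto simp: flow_sums)
  qed
qed

lemma integrable_wlen:
  assumes "i \<in> {1,2}"
  shows "integrable M (wlen t i)"
proof (induction t)
  case 0
  show ?case by (simp add: wlen_def S_0)
next
  case (Suc t)
  then show ?case
    unfolding wlen_balance[OF assms, abs_def]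
    using integrable_comb[of t] arrivals_integral(1)[of t] assms
    by (cases "origin G i = comp_node G") (auto simp: flow_sums)
qed

text \<open>All balances and capacity bounds are linear, so they pass to expectations, which then
  satisfy the assumptions of \<open>fluid_limit\<close>.\<close>

lemma stable_rates:
  "[rate, rate, rate] \<in> flow_region G
     [(source1 G, comp_node G), (source2 G, comp_node G), (comp_node G, dest G)]
   \<and> rate \<le> comp_cap G"
proof (rule fluid_limit)
  let ?F = "\<lambda>t i m k. integral\<^sup>L M (flow t i m k)"
  let ?c = "\<lambda>t. integral\<^sup>L M (comb t)"
  let ?q = "\<lambda>t i k. integral\<^sup>L M (qlen t i k)"
  let ?w = "\<lambda>t i. integral\<^sup>L M (wlen t i)"
  show "0 \<le> ?F t i m k" for t i m k by (simp add: flow_def)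
  show "0 \<le> ?q t i k" for t i k by (simp add: qlen_def)
  show "0 \<le> ?w t i" for t i by (simp add: wlen_def)
  show "(\<Sum>i\<in>{0,1,2}. ?F t i m k + ?F t i k m) \<le> edge_cap G {m, k}" if e: "{m, k} \<in> edges G" for t m k
  proof -
    have e': "{k, m} \<in> edges G" using e by (simp add: insert_commute)
    note int = integrable_flow[OF _ e] integrable_flow[OF _ e']
    have "(\<Sum>i\<in>{0,1,2}. ?F t i m k + ?F t i k m)
        = (\<integral>x. (\<Sum>i\<in>{0,1,2}. flow t i m k x + flow t i k m x) \<partial>M)"
      using int by (subst Bochner_Integration.integral_sum) auto
    also have "\<dots> \<le> edge_cap G {m, k}"
      using int flow_cap[OF e]
      by (intro integral_le_const Bochner_Integration.integrable_sum
          Bochner_Integration.integrable_add) auto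
    finally show ?thesis .
  qed
  show "?F t i (target G i) k = 0" if "i \<in> {0,1,2}" "k \<in> nbrs G (target G i)" for t i k
  proof -
    have "flow t i (target G i) k = (\<lambda>x. 0)"
      using slot.moved_target[OF slot that] by (simp add: flow_def fun_eq_iff)
    then show ?thesis by simp
  qed
  show "?c t \<le> comp_cap G" for t
    using integrable_comb comb_le by (intro integral_le_const) auto
  show "?q (Suc t) i k + (\<Sum>l\<in>nbrs G k. ?F t i k l) = ?q t i k + (\<Sum>m\<in>nbrs G k. ?F t i m k) +
      (if k = origin G i then if i = 0 then ?c t else rate else 0)"
    if "i \<in> {0,1,2}" "k \<in> nodes G" "k \<noteq> target G i" for t i k
  proof -
    \<comment> \<open>Naming the external input lets its case distinction be integrated apart from
      the rest of the balance.\<close>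
    define X where "X x = (if k = origin G i then if i = 0 then comb t x else real (A t x) else 0)" for x
    have X: "integrable M X"
      "integral\<^sup>L M X = (if k = origin G i then if i = 0 then ?c t else rate else 0)"
      unfolding X_def[abs_def]
      by (cases "k = origin G i"; cases "i = 0"; simp add: integrable_comb arrivals_integral)+
    have "qlen (Suc t) i k = (\<lambda>x. qlen t i k x + (\<Sum>m\<in>nbrs G k. flow t i m k x) + X x
        - (\<Sum>l\<in>nbrs G k. flow t i k l x))"
      using qlen_balance[OF that] by (simp add: X_def fun_eq_iff)
    then have "?q (Suc t) i k = ?q t i k + (\<Sum>m\<in>nbrs G k. ?F t i m k) + integral\<^sup>L M X
        - (\<Sum>l\<in>nbrs G k. ?F t i k l)"
      using X(1) integrable_qlen[OF that(1,2)] flow_sums[OF that(1)] by simp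
    then show ?thesis using X(2) by simp
  qed
  show "?w (Suc t) i + ?c t = ?w t i + (\<Sum>m\<in>nbrs G (comp_node G). ?F t i m (comp_node G)) +
      (if origin G i = comp_node G then rate else 0)"
    if "i \<in> {1,2}" for t i
  proof -
    have i': "i \<in> {0,1,2}" using that by auto
    note [simp] = integrable_wlen[OF that] integrable_comb arrivals_integral flow_sums[OF i']
    show ?thesis
      unfolding wlen_balance[OF that, abs_def]
      by (cases "origin G i = comp_node G") simp_all
  qed
  show "\<exists>B. \<forall>\<^sub>F T in sequentially. (\<Sum>t=1..T. ?q t i k) \<le> B * real T"
    if "i \<in> {0,1,2}" "k \<in> nodes G" for i k
    unfolding qlen_def
    by (rule strongly_stable_linear_bound)
      (use stable that integrable_qlen[OF that] in \<open>auto simp: stable_system_def Let_def qlen_def[abs_def]\<close>)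
  show "\<exists>B. \<forall>\<^sub>F T in sequentially. (\<Sum>t=1..T. ?w t i) \<le> B * real T"
    if "i \<in> {1,2}" for i
    unfolding wlen_def
    by (rule strongly_stable_linear_bound)
      (use stable that integrable_wlen[OF that] in \<open>auto simp: stable_system_def Let_def wlen_def[abs_def]\<close>)
qed

end

theorem theorem1:
  fixes G :: "'v network"
    and M :: "'a measure" and A :: "nat \<Rightarrow> 'a \<Rightarrow> nat" and rate :: real
    and N :: "'w measure" and \<xi> :: "'a \<Rightarrow> 'w"
    and p :: "('w, 'v) policy" and s0 :: "'v state"
  assumes "computation_network G"
    and "query_arrivals M A rate"
    and "policy_seed M A N \<xi>"
    and "initial_state G s0"
    and "p \<in> Pi_C G"
    and "measurable_decisions G M A \<xi> p s0"
    and "stable_system G M A \<xi> p s0"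
  shows "[rate, rate, rate] \<in> flow_region G
           [(source1 G, comp_node G), (source2 G, comp_node G), (comp_node G, dest G)]
         \<and> rate \<le> comp_cap G"
proof -
  interpret network_run G M A rate \<xi> p s0
    using assms by unfold_locales
  show ?thesis by (rule stable_rates)
qed

end
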